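(* Let $h\ge 2$ be an integer and let $\mathbb{N}=W_1\cup\cdots\cup W_h$ be a partition of $\mathbb{N}$ into pairwise disjoint sets such that each $W_i$ ($1\le i\le h$) is infinite, $0\in W_1$, and for every $i=2,\dots,h$ the set $W_i$ contains $\lceil \log(h+1)/\log 2\rceil$ consecutive integers. Then $A=A(W_1)\cup\cdots\cup A(W_h)$ is a minimal asymptotic basis of order $h$.
   Context: $\mathbb{N}$ denotes the set of nonnegative integers. For an integer $h\ge 2$ and $A\subseteq\mathbb{N}$, $hA=\{a_1+\cdots+a_h : a_i\in A\}$. A set $A$ is an asymptotic basis of order $h$ if every sufficiently large integer lies in $hA$; it is a minimal asymptotic basis of order $h$ if no proper subset of $A$ is an asymptotic basis of order $h$. For a nonempty $W\subseteq\mathbb{N}$, $A(W)$ denotes the set of all numbers of the form $\sum_{f\in F}2^f$ where $F$ ranges over finite nonempty subsets of $W$. *)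

theory Defs
  imports Complex_Main "HOL-Library.Disjoint_Sets"
begin

definition hfold_sumset :: "nat \<Rightarrow> nat set \<Rightarrow> nat set" where
  "hfold_sumset h A = {\<Sum>i<h. a i | a. \<forall>i<h. a i \<in> A}"

definition asymptotic_basis :: "nat \<Rightarrow> nat set \<Rightarrow> bool" where
  "asymptotic_basis h A \<longleftrightarrow> (\<exists>n0. \<forall>n\<ge>n0. n \<in> hfold_sumset h A)"

definition minimal_asymptotic_basis :: "nat \<Rightarrow> nat set \<Rightarrow> bool" where
  "minimal_asymptotic_basis h A \<longleftrightarrow>
     asymptotic_basis h A \<and> (\<forall>B. B \<subset> A \<longrightarrow> \<not> asymptotic_basis h B)"

definition binary_sums :: "nat set \<Rightarrow> nat set" where
  "binary_sums W = {\<Sum>f\<in>F. 2 ^ f | F. finite F \<and> F \<noteq> {} \<and> F \<subseteq> W}"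

definition contains_consecutive :: "nat \<Rightarrow> nat set \<Rightarrow> bool" where
  "contains_consecutive k W \<longleftrightarrow> (\<exists>m. {m..<m + k} \<subseteq> W)"

end

theory Submission
  imports Defs "HOL-Library.Nat_Bijection"
begin

text \<open>
  Splitting the binary digits of n along the partition writes n as a sum of at most h elements
  of A, and every element of A exceeding 1 is a sum of two elements of A, so the number of
  summands can be raised to exactly h.

  For minimality, let a be an element of A(W_j) and let n have the digits of a together with all
  digits below a large N that lie outside W_j. If W_i contains a run of t digits with
  h < 2^t, then h summands without digits in W_i cannot fill that run, so every class other than
  W_j occurs in each representation of n (for W_1 because n is odd). If W_j occurs too, each class
  occurs once and the summand from W_j must be a. Otherwise one class occurs twice, so n = s + g
  where s and g have no digits in W_j. Since n has digit 1 at every place below N outside W_j,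
  the addition s + g has no carry there, so n has no digit in W_j, a contradiction.
\<close>

section \<open>Binary digit sets and membership in A(W)\<close>

lemma mem_set_decode_iff_bit: "x \<in> set_decode n \<longleftrightarrow> bit n x"
  by (simp add: set_decode_def bit_iff_odd)

lemma set_decode_nonempty: "n \<noteq> 0 \<Longrightarrow> set_decode n \<noteq> {}"
  by (metis set_decode_inverse set_encode_empty)

lemma set_encode_ne_0: "finite F \<Longrightarrow> F \<noteq> {} \<Longrightarrow> set_encode F \<noteq> 0"
  by (metis set_decode_zero set_encode_inverse)

text \<open>Binary expansions are unique, so the exponent set \<open>F\<close> behind a member
  \<open>a\<close> can only be \<open>set_decode a\<close>; the condition that \<open>F\<close> is
  nonempty turns into \<open>a \<noteq> 0\<close>.\<close>

lemma mem_binary_sums_iff: "a \<in> binary_sums V \<longleftrightarrow> a \<noteq> 0 \<and> set_decode a \<subseteq> V"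
proof
  assume "a \<in> binary_sums V"
  then obtain F where F: "finite F" "F \<noteq> {}" "F \<subseteq> V" "a = set_encode F"
    by (auto simp: binary_sums_def set_encode_def)
  then show "a \<noteq> 0 \<and> set_decode a \<subseteq> V"
    by (simp add: set_encode_ne_0)
next
  assume a: "a \<noteq> 0 \<and> set_decode a \<subseteq> V"
  moreover have "a = (\<Sum>f\<in>set_decode a. 2 ^ f)"
    by (metis finite_set_decode set_decode_inverse set_encode_def)
  ultimately show "a \<in> binary_sums V"
    unfolding binary_sums_def using set_decode_nonempty by (blast intro: finite_set_decode)
qed

lemma set_encode_UN_disjoint:
  assumes "finite I" "\<And>i. i \<in> I \<Longrightarrow> finite (F i)" "disjoint_family_on F I"
  shows "set_encode (\<Union>i\<in>I. F i) = (\<Sum>i\<in>I. set_encode (F i))"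
proof -
  have "set_encode (\<Union>i\<in>I. F i) = (\<Sum>x\<in>(\<Union>i\<in>I. F i). 2 ^ x)"
    by (simp add: set_encode_def)
  also have "\<dots> = (\<Sum>i\<in>I. \<Sum>x\<in>F i. 2 ^ x)"
    using assms by (intro sum.UNION_disjoint) (auto simp: disjoint_family_on_def)
  finally show ?thesis by (simp add: set_encode_def)
qed

text \<open>Summands with pairwise disjoint digit sets are added without carries, so the digits of
  each of them remain visible in the sum.\<close>

lemma set_decode_sum_disjoint:
  assumes "finite I" "disjoint_family_on (\<lambda>i. set_decode (a i)) I"
  shows "set_decode (\<Sum>i\<in>I. a i) = (\<Union>i\<in>I. set_decode (a i))"
proof -
  have "set_encode (\<Union>i\<in>I. set_decode (a i)) = (\<Sum>i\<in>I. a i)"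
    using assms by (simp add: set_encode_UN_disjoint)
  then show ?thesis
    using assms(1) by (metis finite_UN finite_set_decode set_encode_inverse)
qed

section \<open>Raising the number of summands, and the basis property\<close>

lemma hfold_sumset_Suc:
  assumes n: "n \<in> hfold_sumset t A" and "t < n"
    and split: "\<And>a. a \<in> A \<Longrightarrow> 2 \<le> a \<Longrightarrow> \<exists>b\<in>A. \<exists>c\<in>A. a = b + c"
  shows "n \<in> hfold_sumset (Suc t) A"
proof -
  obtain a where a: "n = (\<Sum>i<t. a i)" "\<And>i. i < t \<Longrightarrow> a i \<in> A"
    using n by (auto simp: hfold_sumset_def)
  have "\<exists>i<t. 2 \<le> a i"
  proof (rule ccontr)
    assume "\<not> ?thesis"
    then have "(\<Sum>i<t. a i) \<le> (\<Sum>i<t. 1)"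
      by (intro sum_mono) (force simp: not_le)
    with a \<open>t < n\<close> show False by simp
  qed
  then obtain i where i: "i < t" "2 \<le> a i" by blast
  then obtain b c where bc: "b \<in> A" "c \<in> A" "a i = b + c"
    using split a by blast
  \<comment> \<open>The summand to be split is at least 2: its slot \<open>i\<close> keeps
    \<open>b\<close>, and \<open>c\<close> goes into the new slot \<open>t\<close>.\<close>
  define a' where "a' = a(i := b, t := c)"
  have "(\<Sum>k<t. a k) = a i + (\<Sum>k\<in>{..<t} - {i}. a k)"
    using i by (intro sum.remove) auto
  moreover have "(\<Sum>k<t. a' k) = a' i + (\<Sum>k\<in>{..<t} - {i}. a' k)"
    using i by (intro sum.remove) auto
  moreover have "(\<Sum>k\<in>{..<t} - {i}. a' k) = (\<Sum>k\<in>{..<t} - {i}. a k)"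
    by (intro sum.cong) (auto simp: a'_def)
  ultimately have "n = (\<Sum>k<Suc t. a' k)"
    using a bc i by (simp add: a'_def)
  moreover have "\<forall>k<Suc t. a' k \<in> A"
    using a bc by (auto simp: a'_def less_Suc_eq)
  ultimately show ?thesis by (auto simp: hfold_sumset_def)
qed

lemma hfold_sumset_increase:
  assumes "n \<in> hfold_sumset t A" "t \<le> h" "h \<le> n"
    and "\<And>a. a \<in> A \<Longrightarrow> 2 \<le> a \<Longrightarrow> \<exists>b\<in>A. \<exists>c\<in>A. a = b + c"
  shows "n \<in> hfold_sumset h A"
  using assms(2,3)
proof (induction h rule: dec_induct)
  case base
  show ?case by fact
next
  case (step k)
  then show ?case using assms(4) by (intro hfold_sumset_Suc) auto
qed

lemma sum_mem_hfold_sumset_card: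
  assumes "finite C" "\<And>i. i \<in> C \<Longrightarrow> p i \<in> A"
  shows "(\<Sum>i\<in>C. p i) \<in> hfold_sumset (card C) A"
proof -
  obtain f where f: "bij_betw f {..<card C} C"
    using assms(1) ex_bij_betw_nat_finite[of C] by (auto simp: atLeast0LessThan)
  then have "(\<Sum>i\<in>C. p i) = (\<Sum>k<card C. p (f k))"
    by (simp add: sum.reindex_bij_betw)
  moreover have "\<forall>k<card C. p (f k) \<in> A"
    using f assms(2) by (auto dest: bij_betwE)
  ultimately show ?thesis unfolding hfold_sumset_def by blast
qed

text \<open>Every power of 2 belongs to the union because the classes cover all exponents. Hence one
  digit can be split off from \<open>a\<close>, the rest staying in the class of \<open>a\<close>.
  If \<open>a\<close> is itself a power of 2, there is no rest; then \<open>a\<close> is halved,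
  which is possible since \<open>2 \<le> a\<close>.\<close>

lemma binary_sums_split:
  assumes cover: "(\<Union>i\<in>I. W i) = UNIV"
    and a: "a \<in> (\<Union>i\<in>I. binary_sums (W i))" "2 \<le> a"
  shows "\<exists>b\<in>(\<Union>i\<in>I. binary_sums (W i)). \<exists>c\<in>(\<Union>i\<in>I. binary_sums (W i)). a = b + c"
proof -
  obtain i where i: "i \<in> I" "set_decode a \<subseteq> W i"
    using a by (auto simp: mem_binary_sums_iff)
  obtain x where x: "x \<in> set_decode a"
    using a(2) set_decode_nonempty[of a] by auto
  have enc: "set_encode {y} = 2 ^ y" for y by (simp add: set_encode_def)
  have power: "2 ^ y \<in> (\<Union>i\<in>I. binary_sums (W i))" for y :: nat
  proof -
    obtain k where "k \<in> I" "y \<in> W k" using cover by blast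
    moreover have "set_decode (2 ^ y) = {y}"
      by (metis enc finite.intros set_encode_inverse)
    ultimately show ?thesis by (auto simp: mem_binary_sums_iff)
  qed
  have a_eq: "a = 2 ^ x + set_encode (set_decode a - {x})"
  proof -
    have "a = (\<Sum>f\<in>set_decode a. 2 ^ f)"
      by (metis finite_set_decode set_decode_inverse set_encode_def)
    also have "\<dots> = 2 ^ x + (\<Sum>f\<in>set_decode a - {x}. 2 ^ f)"
      using x by (intro sum.remove) auto
    finally show ?thesis by (simp add: set_encode_def)
  qed
  show ?thesis
  proof (cases "set_decode a = {x}")
    case True
    then have "a = 2 ^ x" using a_eq by simp
    with a(2) obtain y where "x = Suc y" by (cases x) auto
    with \<open>a = 2 ^ x\<close> have "a = 2 ^ y + 2 ^ y" by simp
    with power show ?thesis by blast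
  next
    case False
    then have "set_encode (set_decode a - {x}) \<noteq> 0"
      using x by (intro set_encode_ne_0) auto
    then have "set_encode (set_decode a - {x}) \<in> binary_sums (W i)"
      using i by (auto simp: mem_binary_sums_iff)
    with i a_eq power show ?thesis by blast
  qed
qed

lemma asymptotic_basis_binary_sums:
  assumes cover: "(\<Union>i\<in>I. W i) = UNIV" and disj: "disjoint_family_on W I" and "finite I"
  shows "asymptotic_basis (card I) (\<Union>i\<in>I. binary_sums (W i))"
  unfolding asymptotic_basis_def
proof (intro exI allI impI)
  fix n assume n: "card I \<le> n"
  let ?A = "\<Union>i\<in>I. binary_sums (W i)"
  define p where "p i = set_encode (set_decode n \<inter> W i)" for i
  \<comment> \<open>Classes in which \<open>n\<close> has no digit contribute 0, which is never in
    \<open>binary_sums\<close>; they are dropped here, and the lost summands are regained by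
    splitting, for which \<open>card I \<le> n\<close> suffices.\<close>
  define C where "C = {i \<in> I. p i \<noteq> 0}"
  have "(\<Union>i\<in>I. set_decode n \<inter> W i) = set_decode n" using cover by blast
  then have "n = set_encode (\<Union>i\<in>I. set_decode n \<inter> W i)" by simp
  also have "\<dots> = (\<Sum>i\<in>I. p i)"
    unfolding p_def using disj \<open>finite I\<close>
    by (intro set_encode_UN_disjoint) (auto simp: disjoint_family_on_def)
  also have "\<dots> = (\<Sum>i\<in>C. p i)"
    unfolding C_def using \<open>finite I\<close> by (intro sum.mono_neutral_right) auto
  finally have "n = (\<Sum>i\<in>C. p i)" .
  moreover have "p i \<in> ?A" if "i \<in> C" for i
    using that by (auto simp: C_def mem_binary_sums_iff p_def)
  ultimately have "n \<in> hfold_sumset (card C) ?A"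
    using \<open>finite I\<close> sum_mem_hfold_sumset_card[of C p ?A] by (simp add: C_def)
  moreover have "card C \<le> card I"
    using \<open>finite I\<close> by (auto simp: C_def intro: card_mono)
  ultimately show "n \<in> hfold_sumset (card I) ?A"
    by (rule hfold_sumset_increase[OF _ _ n binary_sums_split[OF cover]])
qed

section \<open>Digits of sums: absence of carries and runs of ones\<close>

lemma add_no_carry:
  fixes s g :: nat
  assumes "\<And>x. x < N \<Longrightarrow> \<not> P x \<Longrightarrow> bit (s + g) x"
    and "\<And>x. x < N \<Longrightarrow> P x \<Longrightarrow> \<not> bit s x \<and> \<not> bit g x"
    and "x < N" "P x"
  shows "\<not> bit (s + g) x"
  using assms
proof (induction N arbitrary: s g P x)
  case 0
  then show ?case by simp
next
  case (Suc N)
  \<comment> \<open>No carry leaves place 0: if \<open>P 0\<close> holds, both digits there are 0;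
    otherwise the sum is odd, so exactly one of them is 1. Halving therefore commutes with the
    addition, and the halves satisfy the same hypotheses with \<open>P\<close> shifted by one
    place.\<close>
  have not_both: "\<not> (odd s \<and> odd g)" and parity: "P 0 \<Longrightarrow> even s \<and> even g"
    using Suc.prems(1)[of 0] Suc.prems(2)[of 0] by (auto simp: bit_0)
  from not_both have div: "(s + g) div 2 = s div 2 + g div 2"
    by presburger
  show ?case
  proof (cases x)
    case 0
    then show ?thesis using Suc.prems(4) parity by (simp add: bit_0)
  next
    case (Suc y)
    have "\<not> bit (s div 2 + g div 2) y"
    proof (rule Suc.IH[where P = "\<lambda>z. P (Suc z)"])
      show "bit (s div 2 + g div 2) z" if "z < N" "\<not> P (Suc z)" for z
        using Suc.prems(1)[of "Suc z"] that by (simp add: bit_Suc div)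
      show "\<not> bit (s div 2) z \<and> \<not> bit (g div 2) z" if "z < N" "P (Suc z)" for z
        using Suc.prems(2)[of "Suc z"] that by (simp add: bit_Suc)
    qed (use Suc Suc.prems in auto)
    then show ?thesis by (simp add: Suc bit_Suc div)
  qed
qed

text \<open>Modulo \<open>2 ^ (m + t)\<close> each summand reduces to its part below
  \<open>2 ^ m\<close>. The carry that \<open>h\<close> such parts send into the block is less than
  \<open>h\<close>, whereas a block of ones has the value \<open>2 ^ t - 1\<close>, which is at
  least \<open>h\<close>.\<close>

lemma sum_cannot_fill_block:
  fixes a :: "nat \<Rightarrow> nat"
  assumes "0 < h" "h < 2 ^ t"
    and block: "\<And>x. x \<in> {m..<m + t} \<Longrightarrow> bit (\<Sum>k<h. a k) x"
    and avoid: "\<And>k x. k < h \<Longrightarrow> x \<in> {m..<m + t} \<Longrightarrow> \<not> bit (a k) x"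
  shows False
proof -
  define S where "S = (\<Sum>k<h. take_bit m (a k))"
  have take: "take_bit (m + t) (a k) = take_bit m (a k)" if "k < h" for k
    using avoid[OF that] by (intro bit_eqI) (force simp: bit_take_bit_iff not_less)
  have S_le: "S \<le> h * (2 ^ m - 1)"
  proof -
    have "S \<le> (\<Sum>k<h. 2 ^ m - 1)"
      unfolding S_def by (intro sum_mono) (simp add: Suc_leI take_bit_nat_less_exp le_diff_conv2)
    then show ?thesis by simp
  qed
  \<comment> \<open>Strictness matters: a carry equal to \<open>h\<close> could fill the block when
    \<open>h = 2 ^ t - 1\<close>.\<close>
  also have "\<dots> < h * 2 ^ m" using \<open>0 < h\<close> by simp
  finally have S_lt: "S < h * 2 ^ m" .
  also have "\<dots> \<le> 2 ^ t * 2 ^ m" using \<open>h < 2 ^ t\<close> by simp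
  finally have "S < 2 ^ (m + t)" by (simp add: power_add mult.commute)
  moreover have "take_bit (m + t) (\<Sum>k<h. a k) = take_bit (m + t) S"
  proof -
    have "(\<Sum>k<h. a k) mod 2 ^ (m + t) = (\<Sum>k<h. a k mod 2 ^ (m + t)) mod 2 ^ (m + t)"
      by (simp add: mod_sum_eq)
    also have "(\<Sum>k<h. a k mod 2 ^ (m + t)) = S"
      unfolding S_def using take by (intro sum.cong) (auto simp: take_bit_eq_mod)
    finally show ?thesis by (simp add: take_bit_eq_mod)
  qed
  ultimately have S_eq: "S = take_bit (m + t) (\<Sum>k<h. a k)"
    by (simp add: take_bit_nat_eq_self)
  have "drop_bit m S = mask t"
    unfolding S_eq using block
    by (intro bit_eqI) (auto simp: bit_drop_bit_eq bit_take_bit_iff bit_mask_iff)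
  then have "S div 2 ^ m = 2 ^ t - 1"
    by (simp add: drop_bit_eq_div mask_eq_exp_minus_1)
  moreover have "S div 2 ^ m < h"
    using S_lt by (simp add: less_mult_imp_div_less)
  ultimately show False using \<open>h < 2 ^ t\<close> by simp
qed

text \<open>Turns the run length assumed in the theorem into the inequality that
  \<open>sum_cannot_fill_block\<close> asks for.\<close>

lemma less_two_power_ceiling_log:
  "h < 2 ^ nat \<lceil>ln (real (h + 1)) / ln 2\<rceil>"
proof -
  let ?t = "nat \<lceil>ln (real (h + 1)) / ln 2\<rceil>"
  have "log 2 (real (h + 1)) \<le> real ?t"
    unfolding log_def by (rule real_nat_ceiling_ge)
  then have "real (h + 1) \<le> 2 powr real ?t"
    by (simp add: log_le_iff)
  also have "\<dots> = real (2 ^ ?t)" by (subst powr_realpow) simp_all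
  finally have "h + 1 \<le> 2 ^ ?t" by (simp only: of_nat_le_iff)
  then show ?thesis by simp
qed

section \<open>Distribution of the summands among the classes\<close>

lemma sum_collision_two_disjoint:
  assumes K: "finite K" and disj: "disjoint_family_on W I"
    and c: "\<And>k. k \<in> K \<Longrightarrow> c k \<in> I" "\<And>k. k \<in> K \<Longrightarrow> set_decode (a k) \<subseteq> W (c k)"
    and card: "card K \<le> Suc (card (c ` K))" and "K \<noteq> {}"
  obtains s g where "(\<Sum>k\<in>K. a k) = s + g"
    "set_decode s \<subseteq> (\<Union>i\<in>c ` K. W i)" "set_decode g \<subseteq> (\<Union>i\<in>c ` K. W i)"
proof -
  \<comment> \<open>The bound \<open>card\<close> leaves room for at most one coincidence among the
    values of \<open>c\<close>, so removing one suitable index makes \<open>c\<close> injective. The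
    remaining summands then add without carries to \<open>s\<close>, and the removed one serves as
    \<open>g\<close>.\<close>
  have "\<exists>l\<in>K. inj_on c (K - {l})"
  proof (cases "inj_on c K")
    case True
    then show ?thesis using \<open>K \<noteq> {}\<close> by (auto intro: inj_on_subset)
  next
    case False
    then obtain l l' where l: "l \<in> K" "l' \<in> K" "l \<noteq> l'" "c l = c l'"
      by (auto simp: inj_on_def)
    \<comment> \<open>The class of \<open>l\<close> is still represented by \<open>l'\<close>, so
      the image keeps its size while the domain loses one element.\<close>
    then have "c ` (K - {l}) = c ` K" by (auto simp: image_iff)
    moreover have "Suc (card (K - {l})) = card K" using K l(1) by (rule card_Suc_Diff1)
    ultimately have "card (K - {l}) \<le> card (c ` (K - {l}))" using card by simp
    then have "inj_on c (K - {l})"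
      using K by (intro eq_card_imp_inj_on) (auto intro: antisym card_image_le)
    with l show ?thesis by blast
  qed
  then obtain l where l: "l \<in> K" "inj_on c (K - {l})" by blast
  define s where "s = (\<Sum>k\<in>K - {l}. a k)"
  have "disjoint_family_on (\<lambda>k. set_decode (a k)) (K - {l})"
    unfolding disjoint_family_on_def
  proof (intro ballI impI)
    fix k k' assume k: "k \<in> K - {l}" "k' \<in> K - {l}" "k \<noteq> k'"
    then have "c k \<noteq> c k'" using l by (auto dest: inj_onD)
    then have "W (c k) \<inter> W (c k') = {}"
      using disj c(1) k by (auto simp: disjoint_family_on_def)
    then show "set_decode (a k) \<inter> set_decode (a k') = {}" using c(2) k by blast
  qed
  then have "set_decode s = (\<Union>k\<in>K - {l}. set_decode (a k))"
    unfolding s_def using K by (intro set_decode_sum_disjoint) auto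
  then have "set_decode s \<subseteq> (\<Union>i\<in>c ` K. W i)" using c(2) by auto
  moreover have "set_decode (a l) \<subseteq> (\<Union>i\<in>c ` K. W i)" using c(2) l by auto
  moreover have "(\<Sum>k\<in>K. a k) = s + a l"
    using K l by (simp add: s_def sum.remove[of K l])
  ultimately show ?thesis using that by blast
qed

text \<open>By \<open>onto\<close>, only class \<open>j\<close> can be missing. If it occurs,
  \<open>c\<close> is a bijection onto \<open>I\<close> and the digits of \<open>n\<close> in
  \<open>W j\<close> come from a single summand. If it is missing, \<open>card I\<close> summands
  share \<open>card I - 1\<close> classes, which is the case of one collision.\<close>

lemma binary_sums_summand_forced:
  assumes disj: "disjoint_family_on W I" and "finite I" and j: "j \<in> I"
    and b: "b \<in> binary_sums (W j)" and N: "set_decode b \<subseteq> {..<N}"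
    and n: "set_decode n = set_decode b \<union> ({..<N} - W j)"
    and sum: "n = (\<Sum>k<card I. a k)"
    and c: "\<And>k. k < card I \<Longrightarrow> c k \<in> I \<and> a k \<in> binary_sums (W (c k))"
    and onto: "\<And>i. i \<in> I \<Longrightarrow> i \<noteq> j \<Longrightarrow> i \<in> c ` {..<card I}"
  shows "\<exists>k<card I. a k = b"
proof -
  let ?K = "{..<card I}"
  have dec: "set_decode (a k) \<subseteq> W (c k)" if "k \<in> ?K" for k
    using c that by (simp add: mem_binary_sums_iff)
  have cI: "c ` ?K \<subseteq> I" using c by auto
  have K_ne: "?K \<noteq> {}" using j \<open>finite I\<close> by (auto simp: lessThan_empty_iff card_eq_0_iff)
  show ?thesis
  proof (cases "j \<in> c ` ?K")
    case True
    then have onto_I: "c ` ?K = I" using onto cI by blast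
    then have inj: "inj_on c ?K" by (intro eq_card_imp_inj_on) auto
    obtain l where l: "l < card I" "c l = j" using True by auto
    have others: "set_decode (a k) \<inter> W j = {}" if "k \<in> ?K" "k \<noteq> l" for k
    proof -
      have "c k \<noteq> j" using inj that l by (auto dest: inj_onD)
      then have "W (c k) \<inter> W j = {}"
        using disj cI that(1) j by (auto simp: disjoint_family_on_def)
      then show ?thesis using dec that(1) by blast
    qed
    have "disjoint_family_on (\<lambda>k. set_decode (a k)) ?K"
      unfolding disjoint_family_on_def
    proof (intro ballI impI)
      fix k k' assume k: "k \<in> ?K" "k' \<in> ?K" "k \<noteq> k'"
      then have "c k \<noteq> c k'" using inj by (auto dest: inj_onD)
      then have "W (c k) \<inter> W (c k') = {}"
        using disj cI k by (auto simp: disjoint_family_on_def)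
      then show "set_decode (a k) \<inter> set_decode (a k') = {}" using dec k by blast
    qed
    then have "set_decode n = (\<Union>k\<in>?K. set_decode (a k))"
      unfolding sum by (intro set_decode_sum_disjoint) auto
    then have "set_decode n \<inter> W j = set_decode (a l)"
      using others dec[of l] l by auto
    moreover have "set_decode n \<inter> W j = set_decode b"
      using n b by (auto simp: mem_binary_sums_iff)
    ultimately have "a l = b" by (metis set_decode_inverse)
    with l show ?thesis by blast
  next
    case False
    then have im: "c ` ?K = I - {j}" using onto cI by blast
    have "card ?K \<le> Suc (card (c ` ?K))"
      using j \<open>finite I\<close> unfolding im by (simp add: card_Suc_Diff1 del: card_Diff_insert)
    then obtain s g where sg: "(\<Sum>k\<in>?K. a k) = s + g"
      "set_decode s \<subseteq> (\<Union>i\<in>c ` ?K. W i)" "set_decode g \<subseteq> (\<Union>i\<in>c ` ?K. W i)"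
      using sum_collision_two_disjoint[of ?K W I c a] disj c dec K_ne
      by (metis finite_lessThan lessThan_iff)
    have "(\<Union>i\<in>c ` ?K. W i) \<inter> W j = {}"
      using disj j unfolding im by (auto simp: disjoint_family_on_def)
    then have avoid: "\<not> bit s x \<and> \<not> bit g x" if "x \<in> W j" for x
      using sg(2,3) that by (auto simp flip: mem_set_decode_iff_bit)
    \<comment> \<open>The contradiction arises at any digit \<open>x\<close> of \<open>b\<close>: it
      lies in \<open>W j\<close> and below \<open>N\<close>, so \<open>n\<close> has it, although
      the carry-free sum \<open>s + g\<close> cannot.\<close>
    obtain x where x: "x \<in> set_decode b"
      using b set_decode_nonempty by (auto simp: mem_binary_sums_iff)
    then have xj: "x \<in> W j" "x < N" using b N by (auto simp: mem_binary_sums_iff)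
    have nsg: "n = s + g" using sum sg(1) by simp
    have "\<not> bit (s + g) x"
    proof (rule add_no_carry[where P = "\<lambda>x. x \<in> W j" and N = N])
      show "bit (s + g) y" if "y < N" "y \<notin> W j" for y
        using that n by (simp flip: mem_set_decode_iff_bit nsg)
    qed (use avoid xj in auto)
    moreover have "bit (s + g) x"
      using x n by (simp flip: mem_set_decode_iff_bit nsg)
    ultimately show ?thesis by simp
  qed
qed

section \<open>Choice of the test integer and conclusion\<close>

theorem theorem1p2:
  fixes h :: nat and W :: "nat \<Rightarrow> nat set"
  assumes "h \<ge> 2"
    and "(\<Union>i\<in>{1..h}. W i) = UNIV"
    and "disjoint_family_on W {1..h}"
    and "\<And>i. i \<in> {1..h} \<Longrightarrow> infinite (W i)"
    and "0 \<in> W 1"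
    and "\<And>i. i \<in> {2..h} \<Longrightarrow>
           contains_consecutive (nat \<lceil>ln (real (h + 1)) / ln 2\<rceil>) (W i)"
  shows "minimal_asymptotic_basis h (\<Union>i\<in>{1..h}. binary_sums (W i))"
proof -
  let ?A = "\<Union>i\<in>{1..h}. binary_sums (W i)"
  define t where "t = nat \<lceil>ln (real (h + 1)) / ln 2\<rceil>"
  have ht: "h < 2 ^ t" unfolding t_def by (rule less_two_power_ceiling_log)
  have "\<forall>i\<in>{2..h}. \<exists>m. {m..<m + t} \<subseteq> W i"
    using assms(6) by (simp add: contains_consecutive_def t_def)
  then obtain m where m: "\<And>i. i \<in> {2..h} \<Longrightarrow> {m i..<m i + t} \<subseteq> W i"
    by metis
  have "\<not> asymptotic_basis h B" if "B \<subset> ?A" for B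
  proof
    assume "asymptotic_basis h B"
    then obtain n0 where n0: "\<And>n. n0 \<le> n \<Longrightarrow> n \<in> hfold_sumset h B"
      by (auto simp: asymptotic_basis_def)
    obtain b j where b: "b \<notin> B" "j \<in> {1..h}" "b \<in> binary_sums (W j)"
      using \<open>B \<subset> ?A\<close> by blast
    \<comment> \<open>A second class exists because \<open>2 \<le> h\<close>. Being infinite, it
      supplies a digit \<open>y \<ge> n0\<close> outside \<open>W j\<close>, and this digit makes
      \<open>n\<close> at least \<open>2 ^ y\<close>, hence at least \<open>n0\<close>.\<close>
    obtain i where i: "i \<in> {1..h}" "i \<noteq> j"
    proof (cases "j = 1")
      case True
      then show ?thesis using that[of 2] \<open>h \<ge> 2\<close> by simp
    next
      case False
      then show ?thesis using that[of 1] \<open>h \<ge> 2\<close> by simp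
    qed
    obtain y where y: "n0 \<le> y" "y \<in> W i"
      using assms(4)[OF i(1)] by (meson finite_nat_set_iff_bounded nat_le_linear not_le order_less_imp_le)
    have y_notin: "y \<notin> W j"
      using disjoint_family_onD[OF assms(3) i(1) b(2) i(2)] y(2) by blast
    \<comment> \<open>\<open>N\<close> exceeds \<open>y\<close> and all digits of \<open>b\<close>
      and is at least the end of every chosen run; the sum is a crude bound for all the ends
      \<open>m i + t\<close>. The \<open>Suc\<close> also ensures \<open>0 < N\<close>, so that
      place 0 is covered.\<close>
    define N where "N = Suc (y + Max (set_decode b) + (\<Sum>i\<in>{2..h}. m i + t))"
    have bN: "set_decode b \<subseteq> {..<N}"
    proof
      fix x assume "x \<in> set_decode b"
      then have "x \<le> Max (set_decode b)" by simp
      then show "x \<in> {..<N}" by (simp add: N_def)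
    qed
    have mN: "m i + t \<le> N" if "i \<in> {2..h}" for i
      using member_le_sum[of i "{2..h}" "\<lambda>i. m i + t"] that by (simp add: N_def)
    define n where "n = set_encode (set_decode b \<union> ({..<N} - W j))"
    have dec_n: "set_decode n = set_decode b \<union> ({..<N} - W j)"
      by (simp add: n_def)
    have "y \<in> set_decode n" using y_notin by (simp add: dec_n N_def)
    then have "2 ^ y \<le> n"
      using member_le_sum[of y "set_decode n" "\<lambda>x. 2 ^ x :: nat"]
      by (metis finite_set_decode set_decode_inverse set_encode_def zero_le)
    then have "n0 \<le> n" using y(1) less_exp[of y] by linarith
    then obtain a where a: "n = (\<Sum>k<h. a k)" "\<And>k. k < h \<Longrightarrow> a k \<in> B"
      using n0[of n] by (auto simp: hfold_sumset_def)
    have "\<forall>k. \<exists>i. k < h \<longrightarrow> i \<in> {1..h} \<and> a k \<in> binary_sums (W i)"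
      using a(2) \<open>B \<subset> ?A\<close> by blast
    then obtain c where c: "\<And>k. k < h \<Longrightarrow> c k \<in> {1..h} \<and> a k \<in> binary_sums (W (c k))"
      by metis
    have onto: "i \<in> c ` {..<h}" if i: "i \<in> {1..h}" "i \<noteq> j" for i
    proof (rule ccontr)
      assume miss: "i \<notin> c ` {..<h}"
      have avoid: "\<not> bit (a k) x" if "k < h" "x \<in> W i" for k x
      proof -
        have "c k \<noteq> i" using miss that(1) by blast
        then have "W (c k) \<inter> W i = {}"
          using assms(3) c[OF that(1)] i by (auto simp: disjoint_family_on_def)
        then show ?thesis
          using c[OF that(1)] that(2)
          by (auto simp: mem_binary_sums_iff simp flip: mem_set_decode_iff_bit)
      qed
      have full: "bit (\<Sum>k<h. a k) x" if "x < N" "x \<in> W i" for x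
      proof -
        have "x \<notin> W j"
          using disjoint_family_onD[OF assms(3) i(1) b(2) i(2)] that(2) by blast
        then have "x \<in> set_decode n" using that(1) by (simp add: dec_n)
        then show ?thesis by (simp add: mem_set_decode_iff_bit a(1))
      qed
      show False
      proof (cases "i = 1")
        case True
        \<comment> \<open>No run is assumed in \<open>W 1\<close>. Place 0 alone suffices there:
          summands avoiding \<open>W 1\<close> are all even, so no carry can reach that
          place.\<close>
        then have "even (\<Sum>k<h. a k)"
          using avoid[of _ 0] assms(5) by (intro dvd_sum) (auto simp: bit_0)
        moreover have "odd (\<Sum>k<h. a k)"
          using full[of 0] True assms(5) by (simp add: bit_0 N_def)
        ultimately show False by simp
      next
        case False
        then have i2: "i \<in> {2..h}" using i by auto
        show False
        proof (rule sum_cannot_fill_block[of h t "m i" a])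
          show "bit (\<Sum>k<h. a k) x" if "x \<in> {m i..<m i + t}" for x
            using full[of x] that m[OF i2] mN[OF i2] by auto
          show "\<not> bit (a k) x" if "k < h" "x \<in> {m i..<m i + t}" for k x
            using avoid[of k x] that m[OF i2] by auto
        qed (use ht \<open>h \<ge> 2\<close> in auto)
      qed
    qed
    have "\<exists>k<card {1..h}. a k = b"
      by (rule binary_sums_summand_forced[OF assms(3) _ b(2,3) bN dec_n, where c = c])
        (use a(1) c onto in auto)
    with a(2) b(1) show False by auto
  qed
  moreover have "asymptotic_basis h ?A"
    using asymptotic_basis_binary_sums[OF assms(2,3)] by simp
  ultimately show ?thesis by (simp add: minimal_asymptotic_basis_def)
qed

end
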